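(* Let $\delta\in\{1,2\}$ and $q=p^n$, where $p$ is a prime number and $n\ge 2$ is an integer. Let $f\in\mathbb{F}_q[X_1,X_2]$ be a permutation group polynomial, with permutation polynomial tuple $\underline{\beta}_f=(\beta_0,\beta_1,\ldots,\beta_{q-1})\in \mathfrak{S}_q^{q}$, whose associated group $\{\beta_0,\ldots,\beta_{q-1}\}$ is the group $G=\langle a_0,\ldots,a_{n-\delta}\rangle$ defined in the context. Then there are exactly $q!$ permutation group polynomials over $\mathbb{F}_q$ that are equivalent to $f$.
   Context: Let $\mathbb{F}_q = \{c_0, \ldots, c_{q-1}\}$ be a fixed listing, and let $\mathfrak{S}_q$ be the symmetric group on the set $\mathbb{F}_q$ (products are compositions). Polynomials over $\mathbb{F}_q$ are taken with degree less than $q$ in each variable, i.e. identified with functions. A polynomial $f\in\mathbb{F}_q[X_1,X_2]$ is a local permutation polynomial (LPP) if $f(a,X_2)$ and $f(X_1,a)$ are permutation polynomials of $\mathbb{F}_q$ for every $a\in\mathbb{F}_q$. LPPs correspond bijectively to permutation polynomial tuples, i.e. (ordered) tuples $\underline{\beta}_f=(\beta_0,\ldots,\beta_{q-1})\in\mathfrak{S}_q^q$ such that $\beta_i\beta_j^{-1}$ has no fixed points for $i\ne j$, via $f(x,\beta_i(x))=c_i$ for all $x\in\mathbb{F}_q$ and all $i$. If $\{\beta_0,\ldots,\beta_{q-1}\}$ is a subgroup of $\mathfrak{S}_q$, then $f$ is called a permutation group polynomial and this subgroup is its associated group. Two permutation polynomial tuples $\Omega=(\beta_0,\ldots,\beta_{q-1})$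 and $\Gamma=(\gamma_0,\ldots,\gamma_{q-1})$ are equivalent if there exist $\sigma,\lambda\in\mathfrak{S}_q$ with $\sigma\Omega\lambda=\Gamma$, i.e. $\sigma\beta_i\lambda=\gamma_i$ for all $i$; two LPPs are equivalent if their tuples are. For $\delta\in\{1,2\}$, the group $G$ is generated by $a_0 := \prod_{j=0}^{p^{n-\delta}-1} (c_{jp^{\delta}}, c_{jp^{\delta}+1}, \ldots, c_{jp^{\delta}+p^{\delta}-1})$ and, for $1\le i\le n-\delta$, $a_i := \prod_{j} (c_{j}, c_{j+p^{i+\delta-1}}, \ldots, c_{j+(p-1)p^{i+\delta-1}})$, where the product is over all $0\le j\le q-1$ with $(j \bmod p^{i+\delta}) < p^{i+\delta-1}$. It is an Abelian group of order $q$ in which no non-identity element has a fixed point. *)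

theory Defs
  imports "HOL-Algebra.Bij" "HOL-Algebra.Generated_Groups"
    "HOL-Combinatorics.Cycles" "HOL-Computational_Algebra.Polynomial" "HOL-Library.Cardinality"
begin

text \<open>
  The field $F_q$ is a type \<open>'a :: {field, finite}\<close> with \<open>q = CARD('a)\<close>. A polynomial in
  $F_q[X_1,X_2]$ is an \<open>'a poly poly\<close>: the outer variable is $X_2$, and the coefficients are
  polynomials in $X_1$. The symmetric group on the field is \<open>BijGroup UNIV\<close>.
\<close>

definition eval2 :: "'a::comm_ring_1 poly poly \<Rightarrow> 'a \<Rightarrow> 'a \<Rightarrow> 'a" where
  "eval2 f x y = poly (poly f [:y:]) x"

definition subst_X1 :: "'a::comm_ring_1 poly poly \<Rightarrow> 'a \<Rightarrow> 'a poly" where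
  "subst_X1 f a = map_poly (\<lambda>r. poly r a) f"

definition subst_X2 :: "'a::comm_ring_1 poly poly \<Rightarrow> 'a \<Rightarrow> 'a poly" where
  "subst_X2 f a = poly f [:a:]"

lemma poly_subst_X1: "poly (subst_X1 f a) y = eval2 f a y"
  unfolding subst_X1_def eval2_def by (induction f) (auto simp: map_poly_pCons)

lemma poly_subst_X2: "poly (subst_X2 f a) x = eval2 f x a"
  by (simp add: subst_X2_def eval2_def)

definition permutation_poly :: "'a::comm_ring_1 poly \<Rightarrow> bool" where
  "permutation_poly g \<longleftrightarrow> bij (poly g)"

text \<open>The degree bounds select one polynomial for each function of two variables.\<close>

definition LPP :: "'a::{field,finite} poly poly \<Rightarrow> bool" where
  "LPP f \<longleftrightarrow>
     degree f < CARD('a) \<and> (\<forall>k. degree (coeff f k) < CARD('a)) \<and>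
     (\<forall>a. permutation_poly (subst_X1 f a) \<and> permutation_poly (subst_X2 f a))"

text \<open>
  A $q$-tuple is a function on \<open>nat\<close> of which only the values at \<open>i < CARD('a)\<close> matter.
  The argument \<open>c\<close> is the listing $c_0,\dots,c_{q-1}$ of the field.
\<close>

definition permutation_poly_tuple :: "(nat \<Rightarrow> 'a::finite \<Rightarrow> 'a) \<Rightarrow> bool" where
  "permutation_poly_tuple \<beta> \<longleftrightarrow>
     (\<forall>i<CARD('a). bij (\<beta> i)) \<and>
     (\<forall>i<CARD('a). \<forall>j<CARD('a). i \<noteq> j \<longrightarrow> (\<forall>x. (\<beta> i \<circ> inv_into UNIV (\<beta> j)) x \<noteq> x))"

definition tuple_of :: "(nat \<Rightarrow> 'a::{field,finite}) \<Rightarrow> 'a poly poly \<Rightarrow> nat \<Rightarrow> 'a \<Rightarrow> 'a" where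
  "tuple_of c f i x = (THE y. eval2 f x y = c i)"

lemma eval2_tuple_of:
  assumes "LPP f"
  shows "eval2 f x (tuple_of c f i x) = c i"
proof -
  have "bij (eval2 f x)"
    using assms by (simp add: LPP_def permutation_poly_def poly_subst_X1[abs_def])
  then have "\<exists>!y. eval2 f x y = c i"
    by (simp add: bij_iff)
  then show ?thesis
    unfolding tuple_of_def by (rule theI')
qed

lemma permutation_poly_tuple_tuple_of:
  fixes f :: "'a::{field,finite} poly poly"
  assumes f: "LPP f" and c: "bij_betw c {..<CARD('a)} (UNIV :: 'a set)"
  shows "permutation_poly_tuple (tuple_of c f)"
proof -
  have inj: "inj (\<lambda>x. eval2 f x a)" for a
    using f by (simp add: LPP_def permutation_poly_def poly_subst_X2[abs_def] bij_def)
  have bij: "bij (tuple_of c f i)" for i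
  proof -
    have "inj (tuple_of c f i)"
    proof (rule injI)
      fix x y assume "tuple_of c f i x = tuple_of c f i y"
      then have "eval2 f x (tuple_of c f i x) = eval2 f y (tuple_of c f i x)"
        using eval2_tuple_of[OF f, of x c i] eval2_tuple_of[OF f, of y c i] by simp
      then show "x = y" using inj by (auto dest: injD)
    qed
    then show ?thesis by (simp add: bij_def finite_UNIV_inj_surj)
  qed
  have "(tuple_of c f i \<circ> inv_into UNIV (tuple_of c f j)) x \<noteq> x"
    if "i < CARD('a)" "j < CARD('a)" "i \<noteq> j" for i j x
  proof
    assume eq: "(tuple_of c f i \<circ> inv_into UNIV (tuple_of c f j)) x = x"
    define z where "z = inv_into UNIV (tuple_of c f j) x"
    have "tuple_of c f j z = x"
      unfolding z_def using bij by (simp add: bij_is_surj surj_f_inv_f)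
    moreover have "tuple_of c f i z = x" using eq by (simp add: z_def)
    ultimately have "c i = c j"
      using eval2_tuple_of[OF f, of z c i] eval2_tuple_of[OF f, of z c j] by simp
    then show False using that c by (auto simp: bij_betw_def inj_on_def)
  qed
  with bij show ?thesis by (simp add: permutation_poly_tuple_def)
qed

definition tuple_equiv :: "(nat \<Rightarrow> 'a::finite \<Rightarrow> 'a) \<Rightarrow> (nat \<Rightarrow> 'a \<Rightarrow> 'a) \<Rightarrow> bool" where
  "tuple_equiv \<Omega> \<Gamma> \<longleftrightarrow>
     permutation_poly_tuple \<Omega> \<and> permutation_poly_tuple \<Gamma> \<and>
     (\<exists>\<sigma> \<tau>. bij \<sigma> \<and> bij \<tau> \<and> (\<forall>i<CARD('a). \<sigma> \<circ> \<Omega> i \<circ> \<tau> = \<Gamma> i))"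

definition LPP_equiv ::
  "(nat \<Rightarrow> 'a::{field,finite}) \<Rightarrow> 'a poly poly \<Rightarrow> 'a poly poly \<Rightarrow> bool" where
  "LPP_equiv c f g \<longleftrightarrow> LPP f \<and> LPP g \<and> tuple_equiv (tuple_of c f) (tuple_of c g)"

definition associated_set ::
  "(nat \<Rightarrow> 'a::{field,finite}) \<Rightarrow> 'a poly poly \<Rightarrow> ('a \<Rightarrow> 'a) set" where
  "associated_set c f = tuple_of c f ` {..<CARD('a)}"

definition permutation_group_poly ::
  "(nat \<Rightarrow> 'a::{field,finite}) \<Rightarrow> 'a poly poly \<Rightarrow> bool" where
  "permutation_group_poly c f \<longleftrightarrow>
     LPP f \<and> subgroup (associated_set c f) (BijGroup (UNIV :: 'a set))"

text \<open>
  In each product below the cycles are pairwise disjoint, so the order of composition is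
  immaterial.
\<close>

definition prod_perms :: "('a \<Rightarrow> 'a) list \<Rightarrow> 'a \<Rightarrow> 'a" where
  "prod_perms \<pi>s = foldr (\<circ>) \<pi>s id"

definition gen_a :: "(nat \<Rightarrow> 'a) \<Rightarrow> nat \<Rightarrow> nat \<Rightarrow> nat \<Rightarrow> nat \<Rightarrow> 'a \<Rightarrow> 'a" where
  "gen_a c p n \<delta> i =
     (if i = 0
      then prod_perms (map (\<lambda>j. cycle_of_list (map (\<lambda>k. c (j * p ^ \<delta> + k)) [0..<p ^ \<delta>]))
             [0..<p ^ (n - \<delta>)])
      else prod_perms (map (\<lambda>j. cycle_of_list (map (\<lambda>k. c (j + k * p ^ (i + \<delta> - 1))) [0..<p]))
             (filter (\<lambda>j. j mod p ^ (i + \<delta>) < p ^ (i + \<delta> - 1)) [0..<p ^ n])))"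

definition group_G :: "(nat \<Rightarrow> 'a) \<Rightarrow> nat \<Rightarrow> nat \<Rightarrow> nat \<Rightarrow> ('a \<Rightarrow> 'a) set" where
  "group_G c p n \<delta> = generate (BijGroup UNIV) (gen_a c p n \<delta> ` {0..n - \<delta>})"

end

theory Submission
  imports Defs
begin

text \<open>
  Fix $x_0$. The map $g \mapsto g(x_0, \cdot)$ is a bijection from the permutation group polynomials
  equivalent to $f$ onto the permutations of the field. Write $\gamma$ for the tuple of $g$.
  Its group acts regularly, so $g(x_0, \cdot)$ tells which $\gamma_j$ is the identity. Two such
  polynomials with the same restriction are therefore conjugate, $\gamma'_i = \sigma \gamma_i
  \sigma^{-1}$, so both groups have the same multiplication table in terms of the indices, and
  this table together with the orbit map $i \mapsto \gamma_i(x_0)$ determines the tuple.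
  Conversely, for a permutation $\pi$ with $\pi(x_0) = c_j$, the tuple
  $\sigma \beta_i \beta_j^{-1} \sigma^{-1}$ with $\sigma = \pi^{-1} \circ f(\beta_j^{-1}(x_0), \cdot)$
  has the restriction $\pi$.
\<close>

section \<open>Subgroups and tuples of permutations\<close>

lemma subgroup_BijGroup_UNIV_iff:
  "subgroup A (BijGroup (UNIV :: 'a set)) \<longleftrightarrow>
     (\<forall>h\<in>A. bij h) \<and> (\<forall>h\<in>A. \<forall>k\<in>A. h \<circ> k \<in> A) \<and> id \<in> A \<and> (\<forall>h\<in>A. inv_into UNIV h \<in> A)"
    (is "_ \<longleftrightarrow> ?R")
proof -
  interpret group "BijGroup (UNIV :: 'a set)" by (rule group_BijGroup)
  \<comment> \<open>The operations of \<open>BijGroup\<close> are restricted to its set; over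
    \<open>UNIV\<close> this restriction is vacuous, so they become plain composition and
    \<open>inv_into\<close>.\<close>
  have carrier: "carrier (BijGroup (UNIV :: 'a set)) = {h. bij h}"
    by (simp add: BijGroup_def Bij_def)
  have mult: "h \<otimes>\<^bsub>BijGroup UNIV\<^esub> k = h \<circ> k" if "bij h" "bij k" for h k :: "'a \<Rightarrow> 'a"
    using that by (auto simp: BijGroup_def Bij_def compose_def fun_eq_iff)
  have one: "\<one>\<^bsub>BijGroup UNIV\<^esub> = (id :: 'a \<Rightarrow> 'a)"
    by (auto simp: BijGroup_def fun_eq_iff)
  have inv: "m_inv (BijGroup UNIV) h = inv_into UNIV h" if "bij h" for h :: "'a \<Rightarrow> 'a"
    using that by (auto simp: inv_BijGroup Bij_def fun_eq_iff)
  show ?thesis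
  proof
    assume A: "subgroup A (BijGroup (UNIV :: 'a set))"
    then have "bij h" if "h \<in> A" for h
      using subgroup.mem_carrier[OF A that] by (simp add: carrier)
    then show ?R
      using subgroup.m_closed[OF A] subgroup.one_closed[OF A] subgroup.m_inv_closed[OF A]
      by (metis mult one inv)
  next
    assume R: ?R
    show "subgroup A (BijGroup (UNIV :: 'a set))"
      using R by unfold_locales (auto simp: carrier mult one inv)
  qed
qed

lemma subgroup_BijGroup_conj:
  assumes A: "subgroup A (BijGroup (UNIV :: 'a set))" and \<sigma>: "bij \<sigma>"
  shows "subgroup ((\<lambda>h. \<sigma> \<circ> h \<circ> inv_into UNIV \<sigma>) ` A) (BijGroup (UNIV :: 'a set))"
proof -
  have A': "\<forall>h\<in>A. bij h" "\<And>h k. h \<in> A \<Longrightarrow> k \<in> A \<Longrightarrow> h \<circ> k \<in> A" "id \<in> A"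
    "\<And>h. h \<in> A \<Longrightarrow> inv_into UNIV h \<in> A"
    using A by (auto simp: subgroup_BijGroup_UNIV_iff)
  have \<sigma>': "inv_into UNIV \<sigma> (\<sigma> x) = x" "\<sigma> (inv_into UNIV \<sigma> x) = x" for x
    using \<sigma> by (simp_all add: bij_is_inj bij_is_surj surj_f_inv_f)
  have bij': "bij (inv_into UNIV \<sigma>)" using \<sigma> by (rule bij_imp_bij_inv)
  show ?thesis
    unfolding subgroup_BijGroup_UNIV_iff
  proof (intro conjI ballI)
    fix h assume "h \<in> (\<lambda>h. \<sigma> \<circ> h \<circ> inv_into UNIV \<sigma>) ` A"
    then obtain h' where h': "h' \<in> A" "h = \<sigma> \<circ> h' \<circ> inv_into UNIV \<sigma>" by auto
    have bh': "bij h'" using A' h' by auto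
    show "bij h" unfolding h'(2) using \<sigma> bij' bh' by (intro bij_comp)
    have "inv_into UNIV h = \<sigma> \<circ> inv_into UNIV h' \<circ> inv_into UNIV \<sigma>"
      unfolding h'(2) using bh'
      by (intro inv_unique_comp) (auto simp: fun_eq_iff \<sigma>' bij_is_inj bij_is_surj surj_f_inv_f)
    then show "inv_into UNIV h \<in> (\<lambda>h. \<sigma> \<circ> h \<circ> inv_into UNIV \<sigma>) ` A"
      using A'(4) h'(1) by blast
    fix k assume "k \<in> (\<lambda>h. \<sigma> \<circ> h \<circ> inv_into UNIV \<sigma>) ` A"
    then obtain k' where k': "k' \<in> A" "k = \<sigma> \<circ> k' \<circ> inv_into UNIV \<sigma>" by auto
    have "h \<circ> k = \<sigma> \<circ> (h' \<circ> k') \<circ> inv_into UNIV \<sigma>"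
      by (auto simp: h' k' fun_eq_iff \<sigma>')
    then show "h \<circ> k \<in> (\<lambda>h. \<sigma> \<circ> h \<circ> inv_into UNIV \<sigma>) ` A"
      using A'(2) h'(1) k'(1) by blast
  next
    have "id = \<sigma> \<circ> id \<circ> inv_into UNIV \<sigma>" by (auto simp: fun_eq_iff \<sigma>')
    then show "id \<in> (\<lambda>h. \<sigma> \<circ> h \<circ> inv_into UNIV \<sigma>) ` A" using A'(3) by blast
  qed
qed

text \<open>Normalizing a tuple so that its \<open>j\<close>-th entry becomes the identity composes
  every entry on the right with the inverse of that entry; this only permutes the group.\<close>

lemma subgroup_BijGroup_right_translate:
  assumes A: "subgroup A (BijGroup (UNIV :: 'a set))" and k: "k \<in> A"
  shows "(\<lambda>h. h \<circ> inv_into UNIV k) ` A = A"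
proof -
  have A': "\<forall>h\<in>A. bij h" "\<And>h k. h \<in> A \<Longrightarrow> k \<in> A \<Longrightarrow> h \<circ> k \<in> A"
    "\<And>h. h \<in> A \<Longrightarrow> inv_into UNIV h \<in> A"
    using A by (auto simp: subgroup_BijGroup_UNIV_iff)
  have "h \<in> (\<lambda>h. h \<circ> inv_into UNIV k) ` A" if "h \<in> A" for h
  proof
    show "h = (h \<circ> k) \<circ> inv_into UNIV k"
      using A'(1) k by (auto simp: fun_eq_iff bij_is_surj surj_f_inv_f)
  qed (use A' k that in auto)
  then show ?thesis using A' k by auto
qed

lemma permutation_poly_tuple_iff:
  "permutation_poly_tuple (\<beta> :: nat \<Rightarrow> 'a::finite \<Rightarrow> 'a) \<longleftrightarrow>
     (\<forall>i<CARD('a). bij (\<beta> i)) \<and> (\<forall>x. inj_on (\<lambda>i. \<beta> i x) {..<CARD('a)})"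
proof -
  have "(\<forall>x. (\<beta> i \<circ> inv_into UNIV (\<beta> j)) x \<noteq> x) \<longleftrightarrow> (\<forall>x. \<beta> i x \<noteq> \<beta> j x)" if "bij (\<beta> j)" for i j
  proof -
    have "inv_into UNIV (\<beta> j) (\<beta> j x) = x" "\<beta> j (inv_into UNIV (\<beta> j) x) = x" for x
      using that by (simp_all add: bij_is_inj bij_is_surj surj_f_inv_f)
    then show ?thesis by (metis comp_apply)
  qed
  then show ?thesis
    unfolding permutation_poly_tuple_def inj_on_def lessThan_iff by blast
qed

section \<open>Polynomials of bounded degree as functions\<close>

lemma lagrange_basis_ex:
  "\<exists>d :: 'a::{field,finite} poly. degree d < CARD('a) \<and> (\<forall>y. poly d y = (if y = b then 1 else 0))"
proof -
  \<comment> \<open>The factor for \<open>a\<close> is (X - a)/(b - a): it vanishes at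
    \<open>a\<close> and is 1 at \<open>b\<close>. There are q - 1 factors of degree at most
    1.\<close>
  define d where "d = (\<Prod>a\<in>UNIV - {b}. [:- a / (b - a), 1 / (b - a):])"
  have "degree d \<le> (\<Sum>a\<in>UNIV - {b}. degree [:- a / (b - a), 1 / (b - a):])"
    unfolding d_def by (rule order.trans[OF degree_prod_sum_le]) auto
  also have "\<dots> \<le> (\<Sum>a\<in>UNIV - {b}. 1)" by (intro sum_mono) auto
  also have "\<dots> < CARD('a)" by (simp add: card_Diff_singleton)
  finally have "degree d < CARD('a)" .
  moreover have "poly d y = (if y = b then 1 else 0)" for y
  proof (cases "y = b")
    case True
    have "poly d b = (\<Prod>a\<in>UNIV - {b}. 1)"
      unfolding d_def poly_prod by (intro prod.cong) (auto simp: divide_simps)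
    with True show ?thesis by simp
  next
    case False
    have "poly d y = 0"
      unfolding d_def poly_prod
      by (rule prod_zero) (use False in \<open>auto intro!: bexI[of _ y]\<close>)
    with False show ?thesis by simp
  qed
  ultimately show ?thesis by blast
qed

lemma eval2_interpolation_ex:
  fixes h :: "'a::{field,finite} \<Rightarrow> 'a \<Rightarrow> 'a"
  shows "\<exists>f. degree f < CARD('a) \<and> (\<forall>k. degree (coeff f k) < CARD('a)) \<and> eval2 f = h"
proof -
  obtain d :: "'a \<Rightarrow> 'a poly"
    where d: "\<And>b. degree (d b) < CARD('a)" "\<And>b y. poly (d b) y = (if y = b then 1 else 0)"
    using lagrange_basis_ex by metis
  \<comment> \<open>Lagrange interpolation on the grid: \<open>d a\<close> is used in the
    coefficients, hence in X1, while \<open>map_poly\<close> lifts \<open>d b\<close> to the outer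
    variable X2 with constant coefficients.\<close>
  define f where
    "f = (\<Sum>a\<in>UNIV. \<Sum>b\<in>UNIV. smult (smult (h a b) (d a)) (map_poly (\<lambda>r. [:r:]) (d b)))"
  have "degree f < CARD('a)"
    unfolding f_def
    by (intro degree_sum_less order.strict_trans1[OF degree_smult_le]
        order.strict_trans1[OF map_poly_degree_leq] d) auto
  moreover have "degree (coeff f k) < CARD('a)" for k
    unfolding f_def coeff_sum
    by (intro degree_sum_less)
      (auto simp: coeff_map_poly intro!: order.strict_trans1[OF degree_smult_le] d)
  moreover have "eval2 f x y = h x y" for x y
  proof -
    have const: "poly (poly (map_poly (\<lambda>r. [:r:]) g) [:y:]) x = poly g y" for g :: "'a poly"
      by (induction g) (auto simp: map_poly_pCons)
    have "eval2 f x y =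
        (\<Sum>a\<in>UNIV. \<Sum>b\<in>UNIV. h a b * (if x = a then 1 else 0) * (if y = b then 1 else 0))"
      by (simp add: eval2_def f_def poly_sum const d mult.assoc)
    also have "\<dots> = (\<Sum>a\<in>UNIV. if x = a then \<Sum>b\<in>UNIV. if y = b then h a b else 0 else 0)"
      by (intro sum.cong refl) (simp add: if_distrib[of "\<lambda>t. h _ _ * t"] cong: if_cong)
    finally show ?thesis by simp
  qed
  ultimately show ?thesis by (intro exI[of _ f]) (auto simp: fun_eq_iff)
qed

lemma poly_eq_of_degree_less_card:
  fixes g h :: "'a::{field,finite} poly"
  assumes "degree g < CARD('a)" "degree h < CARD('a)" "poly g = poly h"
  shows "g = h"
proof (rule ccontr)
  assume "g \<noteq> h"
  then have nz: "g - h \<noteq> 0" by simp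
  have "{x. poly (g - h) x = 0} = UNIV" using assms(3) by auto
  then have "CARD('a) \<le> degree (g - h)" using card_poly_roots_bound[OF nz] by simp
  also have "\<dots> < CARD('a)" using assms(1,2) by (rule degree_diff_less)
  finally show False by simp
qed

text \<open>The one-variable uniqueness is applied twice: in X2 after setting X1 = a, and then in X1
  to each coefficient.\<close>

lemma eval2_inject:
  fixes f g :: "'a::{field,finite} poly poly"
  assumes f: "degree f < CARD('a)" "\<And>k. degree (coeff f k) < CARD('a)"
    and g: "degree g < CARD('a)" "\<And>k. degree (coeff g k) < CARD('a)"
    and eq: "eval2 f = eval2 g"
  shows "f = g"
proof -
  have "subst_X1 f a = subst_X1 g a" for a
  proof (rule poly_eq_of_degree_less_card)
    show "degree (subst_X1 f a) < CARD('a)" "degree (subst_X1 g a) < CARD('a)"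
      unfolding subst_X1_def
      using f(1) g(1) by (auto intro: order.strict_trans1[OF map_poly_degree_leq])
    show "poly (subst_X1 f a) = poly (subst_X1 g a)"
      by (simp add: fun_eq_iff poly_subst_X1 eq)
  qed
  then have "coeff (subst_X1 f a) k = coeff (subst_X1 g a) k" for a k by simp
  then have "poly (coeff f k) = poly (coeff g k)" for k
    by (simp add: subst_X1_def coeff_map_poly fun_eq_iff)
  then have "coeff f k = coeff g k" for k
    using f(2) g(2) by (intro poly_eq_of_degree_less_card)
  then show ?thesis by (simp add: poly_eq_iff)
qed

section \<open>The correspondence between LPPs and tuples\<close>

lemma LPP_iff_bij_eval2:
  "LPP (f :: 'a::{field,finite} poly poly) \<longleftrightarrow>
     degree f < CARD('a) \<and> (\<forall>k. degree (coeff f k) < CARD('a)) \<and>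
     (\<forall>a. bij (eval2 f a) \<and> bij (\<lambda>x. eval2 f x a))"
  by (simp add: LPP_def permutation_poly_def poly_subst_X1[abs_def] poly_subst_X2[abs_def])

text \<open>Replaces the definite description in \<open>tuple_of\<close> by the equation f(x, y) =
  c_i, the form in which tuples are used below.\<close>

lemma tuple_of_eq_iff:
  assumes "LPP f"
  shows "tuple_of c f i x = y \<longleftrightarrow> eval2 f x y = c i"
proof
  assume "eval2 f x y = c i"
  with eval2_tuple_of[OF assms, of x c i]
  have "eval2 f x (tuple_of c f i x) = eval2 f x y" by simp
  moreover have "inj (eval2 f x)" using assms by (simp add: LPP_iff_bij_eval2 bij_is_inj)
  ultimately show "tuple_of c f i x = y" by (rule injD[rotated])
qed (use eval2_tuple_of[OF assms] in auto)

lemma LPP_of_tuple_ex: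
  fixes c :: "nat \<Rightarrow> 'a::{field,finite}"
  assumes c: "bij_betw c {..<CARD('a)} (UNIV :: 'a set)" and \<gamma>: "permutation_poly_tuple \<gamma>"
  shows "\<exists>g. LPP g \<and> (\<forall>i<CARD('a). tuple_of c g i = \<gamma> i)"
proof -
  have bij: "bij_betw (\<lambda>i. \<gamma> i x) {..<CARD('a)} UNIV" for x
  proof -
    have inj: "inj_on (\<lambda>i. \<gamma> i x) {..<CARD('a)}"
      using \<gamma> by (simp add: permutation_poly_tuple_iff)
    moreover have "(\<lambda>i. \<gamma> i x) ` {..<CARD('a)} = UNIV"
      by (rule card_subset_eq) (simp_all add: card_image[OF inj])
    ultimately show ?thesis by (simp add: bij_betw_def)
  qed
  \<comment> \<open>\<open>ix x y\<close> is the unique index i with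
    \<open>\<gamma> i x = y\<close>; the required LPP must take the value \<open>c (ix x y)\<close>
    at (x, y).\<close>
  define ix where "ix x = the_inv_into {..<CARD('a)} (\<lambda>i. \<gamma> i x)" for x
  have ix: "bij_betw (ix x) UNIV {..<CARD('a)}" for x
    unfolding ix_def by (rule bij_betw_the_inv_into[OF bij])
  have \<gamma>_ix: "\<gamma> (ix x y) x = y" for x y
    unfolding ix_def by (rule f_the_inv_into_f_bij_betw[OF bij]) simp
  have ix_\<gamma>: "ix x (\<gamma> i x) = i" if "i < CARD('a)" for i x
    unfolding ix_def using bij[of x] that by (intro the_inv_into_f_f) (auto simp: bij_betw_def)
  obtain g where g: "degree g < CARD('a)" "\<forall>k. degree (coeff g k) < CARD('a)"
    "eval2 g = (\<lambda>x y. c (ix x y))"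
    using eval2_interpolation_ex[of "\<lambda>x y. c (ix x y)"] by blast
  have "bij (eval2 g x)" for x
    using bij_betw_trans[OF ix c] by (simp add: g(3) o_def)
  moreover have "bij (\<lambda>x. eval2 g x y)" for y
  proof -
    have "inj (\<lambda>x. eval2 g x y)"
    proof (rule injI)
      \<comment> \<open>Equal values give a common index i, and then the injective
        \<open>\<gamma> i\<close> sends both \<open>x\<close> and \<open>x'\<close> to
        \<open>y\<close>.\<close>
      fix x x' assume "eval2 g x y = eval2 g x' y"
      then have "ix x y = ix x' y"
        using c ix by (metis UNIV_I bij_betw_apply bij_betw_imp_inj_on g(3) inj_onD)
      moreover have "ix x y < CARD('a)" using bij_betw_apply[OF ix] by auto
      then have "inj (\<gamma> (ix x y))"
        using \<gamma> by (auto simp: permutation_poly_tuple_iff bij_is_inj)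
      ultimately show "x = x'" using \<gamma>_ix by (metis injD)
    qed
    then show ?thesis by (simp add: bij_def finite_UNIV_inj_surj)
  qed
  ultimately have LPP: "LPP g" using g by (simp add: LPP_iff_bij_eval2)
  moreover have "tuple_of c g i = \<gamma> i" if "i < CARD('a)" for i
    using that by (auto simp: fun_eq_iff tuple_of_eq_iff[OF LPP] g(3) ix_\<gamma>)
  ultimately show ?thesis by blast
qed

section \<open>Counting by restriction to a base point\<close>

context
  fixes c :: "nat \<Rightarrow> 'a::{field,finite}" and f :: "'a poly poly"
  assumes c: "bij_betw c {..<CARD('a)} (UNIV :: 'a set)"
    and f: "permutation_group_poly c f"
begin

lemma index_ex: "\<exists>i<CARD('a). c i = y"
  using c by (metis UNIV_I bij_betw_iff_bijections lessThan_iff)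

lemma index_inject: "i < CARD('a) \<Longrightarrow> j < CARD('a) \<Longrightarrow> c i = c j \<Longrightarrow> i = j"
  using c by (auto simp: bij_betw_def inj_on_def)

text \<open>Injectivity of the restriction to X1 = x0.\<close>

lemma equiv_group_poly_unique:
  assumes g: "permutation_group_poly c g" "LPP_equiv c f g"
    and h: "permutation_group_poly c h" "LPP_equiv c f h"
    and eq: "eval2 g x0 = eval2 h x0"
  shows "g = h"
proof -
  let ?T = "tuple_of c"
  have LPP: "LPP g" "LPP h" using g h by (auto simp: permutation_group_poly_def)
  have base: "?T g i x0 = ?T h i x0" for i
    by (simp add: tuple_of_def eq)
  obtain j where j: "j < CARD('a)" "c j = eval2 g x0 x0" using index_ex by blast
  \<comment> \<open>The identity occurs at some index m of the tuple of \<open>k\<close>, and k(x0,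
    x0) = c_m since the identity fixes x0. So the restriction determines m.\<close>
  have identity: "?T k j = id" if "permutation_group_poly c k" "eval2 k x0 = eval2 g x0" for k
  proof -
    have "id \<in> associated_set c k"
      using that(1) by (simp add: permutation_group_poly_def subgroup_BijGroup_UNIV_iff)
    then obtain m where m: "m < CARD('a)" "?T k m = id" by (auto simp: associated_set_def)
    then have "eval2 k x0 x0 = c m"
      using that(1) tuple_of_eq_iff[of k c m x0 x0] by (simp add: permutation_group_poly_def)
    then show ?thesis using index_inject j m that(2) by metis
  qed
  have gid: "?T g j = id" and hid: "?T h j = id" using identity g(1) h(1) eq by auto
  obtain \<sigma>1 \<tau>1 where 1: "bij \<sigma>1" "bij \<tau>1" "\<And>i. i < CARD('a) \<Longrightarrow> \<sigma>1 \<circ> ?T f i \<circ> \<tau>1 = ?T g i"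
    using g(2) unfolding LPP_equiv_def tuple_equiv_def by blast
  obtain \<sigma>2 \<tau>2 where 2: "bij \<sigma>2" "bij \<tau>2" "\<And>i. i < CARD('a) \<Longrightarrow> \<sigma>2 \<circ> ?T f i \<circ> \<tau>2 = ?T h i"
    using h(2) unfolding LPP_equiv_def tuple_equiv_def by blast
  \<comment> \<open>Eliminates the tuple of \<open>f\<close>, relating those of \<open>g\<close> and
    \<open>h\<close> directly.\<close>
  define \<sigma> where "\<sigma> = \<sigma>2 \<circ> inv_into UNIV \<sigma>1"
  define \<tau> where "\<tau> = inv_into UNIV \<tau>1 \<circ> \<tau>2"
  have bij: "bij \<sigma>" unfolding \<sigma>_def using 1 2 by (intro bij_comp bij_imp_bij_inv)
  have h_conj: "?T h i x = \<sigma> (?T g i (\<tau> x))" if "i < CARD('a)" for i x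
    using 1(1,2) 1(3)[OF that, symmetric] 2(3)[OF that, symmetric]
    by (simp add: \<sigma>_def \<tau>_def bij_is_inj bij_is_surj surj_f_inv_f)
  \<comment> \<open>At index \<open>j\<close> both entries are the identity, so the equivalence of
    the two tuples is a conjugation.\<close>
  have \<sigma>\<tau>: "\<sigma> (\<tau> x) = x" for x using h_conj[OF j(1), of x] gid hid by simp
  then have \<tau>\<sigma>: "\<tau> (\<sigma> x) = x" for x using bij by (metis bij_is_inj injD)
  have tuples: "?T h i x = ?T g i x" if i: "i < CARD('a)" for i x
  proof -
    \<comment> \<open>Transitivity: x is the image of x0 under entry \<open>k\<close>, so entry i at
      x becomes a product of two entries at x0, where both tuples agree.\<close>
    obtain k where k: "k < CARD('a)" "c k = eval2 g x0 x" using index_ex by blast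
    have x: "?T g k x0 = x" using k LPP by (simp add: tuple_of_eq_iff)
    have "?T g i \<circ> ?T g k \<in> associated_set c g"
      using g(1) i k by (auto simp: permutation_group_poly_def subgroup_BijGroup_UNIV_iff
          associated_set_def)
    then obtain m where m: "m < CARD('a)" "?T g i \<circ> ?T g k = ?T g m"
      by (auto simp: associated_set_def)
    have "?T h i x = ?T h i (?T h k x0)" using x base by simp
    also have "\<dots> = \<sigma> ((?T g i \<circ> ?T g k) (\<tau> x0))" using i k by (simp add: h_conj \<tau>\<sigma>)
    \<comment> \<open>Conjugation preserves the multiplication table: the index m of the product,
      found in the group of \<open>g\<close>, also serves for \<open>h\<close>.\<close>
    also have "\<dots> = ?T h m x0" using m by (simp only: h_conj)
    also have "\<dots> = (?T g i \<circ> ?T g k) x0" using m base by simp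
    also have "\<dots> = ?T g i x" using x by simp
    finally show ?thesis .
  qed
  have "eval2 g x y = eval2 h x y" for x y
  proof -
    obtain i where i: "i < CARD('a)" "c i = eval2 g x y" using index_ex by blast
    then have "?T g i x = y" using LPP by (simp add: tuple_of_eq_iff)
    then have "?T h i x = y" using tuples i by simp
    then show ?thesis using LPP i by (simp add: tuple_of_eq_iff)
  qed
  then have "eval2 g = eval2 h" by (simp add: fun_eq_iff)
  then show ?thesis using LPP eval2_inject by (auto simp: LPP_def)
qed

text \<open>Surjectivity of the restriction: every permutation of the field is attained.\<close>

lemma equiv_group_poly_ex:
  assumes \<pi>: "bij \<pi>"
  shows "\<exists>g. permutation_group_poly c g \<and> LPP_equiv c f g \<and> eval2 g x0 = \<pi>"
proof -
  let ?\<beta> = "tuple_of c f"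
  have LPP: "LPP f" and sub: "subgroup (associated_set c f) (BijGroup UNIV)"
    using f by (auto simp: permutation_group_poly_def)
  have \<beta>: "permutation_poly_tuple ?\<beta>" using permutation_poly_tuple_tuple_of[OF LPP c] .
  obtain j where j: "j < CARD('a)" "c j = \<pi> x0" using index_ex by blast
  have bij_\<beta>: "bij (?\<beta> i)" if "i < CARD('a)" for i
    using \<beta> that by (simp add: permutation_poly_tuple_def)
  define z where "z = inv_into UNIV (?\<beta> j) x0"
  have z: "?\<beta> j z = x0" unfolding z_def using bij_\<beta>[OF j(1)] by (simp add: bij_is_surj surj_f_inv_f)
  define \<sigma> where "\<sigma> = inv_into UNIV \<pi> \<circ> eval2 f z"
  have \<sigma>: "bij \<sigma>"
    unfolding \<sigma>_def using LPP \<pi> by (intro bij_comp bij_imp_bij_inv) (simp_all add: LPP_iff_bij_eval2)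
  \<comment> \<open>The choice of \<open>j\<close> makes \<open>\<sigma>\<close> fix x0, so
    conjugating by it does not move the base point.\<close>
  have "eval2 f z x0 = \<pi> x0" using z j LPP by (simp add: tuple_of_eq_iff)
  then have "\<sigma> x0 = x0" using \<pi> by (simp add: \<sigma>_def bij_is_inj)
  then have \<sigma>x0: "inv_into UNIV \<sigma> x0 = x0" using \<sigma> by (metis bij_inv_eq_iff)
  define \<tau> where "\<tau> = inv_into UNIV (?\<beta> j) \<circ> inv_into UNIV \<sigma>"
  have \<tau>: "bij \<tau>" unfolding \<tau>_def using bij_\<beta>[OF j(1)] \<sigma> by (intro bij_comp bij_imp_bij_inv)
  define \<gamma> where "\<gamma> i = \<sigma> \<circ> ?\<beta> i \<circ> \<tau>" for i
  have \<gamma>: "permutation_poly_tuple \<gamma>"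
    unfolding permutation_poly_tuple_iff
  proof (intro conjI allI impI)
    fix i assume "i < CARD('a)"
    then show "bij (\<gamma> i)" unfolding \<gamma>_def using \<sigma> \<tau> bij_\<beta> by (intro bij_comp)
  next
    fix x
    have "inj_on (\<lambda>i. ?\<beta> i (\<tau> x)) {..<CARD('a)}"
      using \<beta> by (simp add: permutation_poly_tuple_iff)
    then have "inj_on (\<sigma> \<circ> (\<lambda>i. ?\<beta> i (\<tau> x))) {..<CARD('a)}"
      using \<sigma> by (intro comp_inj_on) (auto simp: bij_def intro: inj_on_subset)
    then show "inj_on (\<lambda>i. \<gamma> i x) {..<CARD('a)}" by (simp add: \<gamma>_def o_def)
  qed
  obtain g where g: "LPP g" "\<And>i. i < CARD('a) \<Longrightarrow> tuple_of c g i = \<gamma> i"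
    using LPP_of_tuple_ex[OF c \<gamma>] by blast
  \<comment> \<open>The new set is the \<open>\<sigma>\<close>-conjugate of a right translate of the
    group of \<open>f\<close>, and that translate is the group itself.\<close>
  have "associated_set c g = \<gamma> ` {..<CARD('a)}"
    unfolding associated_set_def using g(2) by (intro image_cong) auto
  also have "\<dots> = (\<lambda>h. \<sigma> \<circ> h \<circ> inv_into UNIV \<sigma>) `
      (\<lambda>h. h \<circ> inv_into UNIV (?\<beta> j)) ` associated_set c f"
    by (simp add: associated_set_def image_image \<gamma>_def \<tau>_def o_assoc)
  also have "(\<lambda>h. h \<circ> inv_into UNIV (?\<beta> j)) ` associated_set c f = associated_set c f"
    using subgroup_BijGroup_right_translate[OF sub] j by (simp add: associated_set_def)
  finally have "subgroup (associated_set c g) (BijGroup UNIV)"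
    using subgroup_BijGroup_conj[OF sub \<sigma>] by (simp only:)
  then have "permutation_group_poly c g" using g by (simp add: permutation_group_poly_def)
  moreover have "LPP_equiv c f g"
    unfolding LPP_equiv_def tuple_equiv_def
    using LPP g \<beta> permutation_poly_tuple_tuple_of[OF g(1) c] \<sigma> \<tau> by (auto simp: \<gamma>_def)
  moreover have "eval2 g x0 y = \<pi> y" for y
  proof -
    obtain i where i: "i < CARD('a)" "c i = \<pi> y" using index_ex by blast
    have "\<gamma> i x0 = \<sigma> (?\<beta> i z)" by (simp add: \<gamma>_def \<tau>_def \<sigma>x0 z_def)
    also have "\<dots> = inv_into UNIV \<pi> (c i)" using LPP by (simp add: \<sigma>_def eval2_tuple_of)
    also have "\<dots> = y" using i \<pi> by (simp add: bij_is_inj)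
    finally have "tuple_of c g i x0 = y" using g i by simp
    then show ?thesis using g(1) i by (simp add: tuple_of_eq_iff)
  qed
  ultimately show ?thesis by (auto simp: fun_eq_iff)
qed

lemma card_equiv_group_polys:
  "card {g. permutation_group_poly c g \<and> LPP_equiv c f g} = fact (CARD('a))"
proof -
  \<comment> \<open>Any base point would serve; 0 is taken.\<close>
  have "bij_betw (\<lambda>g. eval2 g 0) {g. permutation_group_poly c g \<and> LPP_equiv c f g}
      {\<pi> :: 'a \<Rightarrow> 'a. bij \<pi>}"
  proof (intro bij_betw_imageI subset_antisym subsetI)
    show "inj_on (\<lambda>g. eval2 g 0) {g. permutation_group_poly c g \<and> LPP_equiv c f g}"
      using equiv_group_poly_unique by (auto intro!: inj_onI)
  next
    fix \<pi> :: "'a \<Rightarrow> 'a" assume "\<pi> \<in> {\<pi>. bij \<pi>}"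
    then show "\<pi> \<in> (\<lambda>g. eval2 g 0) ` {g. permutation_group_poly c g \<and> LPP_equiv c f g}"
      using equiv_group_poly_ex[of \<pi> 0] by auto
  qed (auto simp: permutation_group_poly_def LPP_iff_bij_eval2)
  then have "card {g. permutation_group_poly c g \<and> LPP_equiv c f g} = card {\<pi> :: 'a \<Rightarrow> 'a. bij \<pi>}"
    by (rule bij_betw_same_card)
  also have "{\<pi> :: 'a \<Rightarrow> 'a. bij \<pi>} = {\<pi>. \<pi> permutes UNIV}"
    by (auto simp: permutes_bij intro: bij_imp_permutes)
  also have "card \<dots> = fact (CARD('a))" by (intro card_permutations) auto
  finally show ?thesis .
qed

end

theorem corollary4p6:
  fixes f :: "'a::{field,finite} poly poly"
    and c :: "nat \<Rightarrow> 'a"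
    and p n \<delta> :: nat
  assumes "\<delta> \<in> {1, 2}"
    and "prime p"
    and "n \<ge> 2"
    and "CARD('a) = p ^ n"
    and "bij_betw c {..<CARD('a)} (UNIV :: 'a set)"
    and "permutation_group_poly c f"
    and "associated_set c f = group_G c p n \<delta>"
  shows "card {g. permutation_group_poly c g \<and> LPP_equiv c f g} = fact (CARD('a))"
  using assms(5,6) by (rule card_equiv_group_polys)

end
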